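(* Let $\mathcal{P}\subset\mathbb{R}^n$ be a pure $n$-dimensional hereditary polytopal complex and $r\ge0$ an integer. Then $LS^{r,n}(\mathcal{P})=C^r(\mathcal{P})$.
   Context: A polytopal complex $\mathcal{P}\subset\mathbb{R}^n$ is a finite set of convex polytopes (faces) such that every face of a member is a member and the intersection of any two members is a (possibly empty) face of both. It is pure $n$-dimensional if all its maximal faces (called facets) have dimension $n$. $\mathcal{P}_i$ is the set of $i$-faces and $\mathcal{P}_i^0$ the set of interior $i$-faces (an $(n-1)$-face is interior iff it lies in two facets). $G(\mathcal{P})$ is the graph on the facets in which $\sigma,\sigma'$ are adjacent iff $\sigma\cap\sigma'\in\mathcal{P}_{n-1}$. The star $\mathrm{st}(\gamma)$ of a face $\gamma$ is the subcomplex of all faces of facets containing $\gamma$. $\mathcal{P}$ is hereditary if $G(\mathrm{st}(\gamma))$ is connected for every nonempty $\gamma\in\mathcal{P}$. $R=\mathbb{R}[x_1,\dots,x_n]$. For $\tau\in\mathcal{P}_{n-1}$, $l_\tau\in R$ is a degree-one polynomial generating the ideal of the affine span of $\tau$. $C^r(\mathcal{P})$ is the $R$-module of piecewise polynomial functions on $\mathcal{P}$ continuously differentiable of order $r$, identified with the tuples $F=(F_\sigma)\in\bigoplus_{\sigma\in\mathcal{P}_n}R$ such that $l_\tau^{r+1}$ divides $F_\sigma-F_{\sigma'}$ whenever $\sigma\cap\sigma'=\tau\in\mathcal{P}_{n-1}$. For a subcomplex $\mathcal{Q}\subset\mathcal{P}$ generated by facets of $\mathcal{P}$, $C^r_{\mathcal{Q}}(\mathcal{P})=\{F\in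 C^r(\mathcal{P}): F_\sigma=0 \text{ for all facets }\sigma\notin\mathcal{Q}\}$. For an interior $(n-1)$-face $\tau$ of $\mathcal{P}$, let $H_\tau\subset\mathbb{R}^{n+1}$ be the linear span of $\{1\}\times\tau$. $L_{\widehat{\mathcal{P}}}$ is the set of all intersections of the hyperplanes $H_\tau$, $\tau\in\mathcal{P}_{n-1}^0$ (including the empty intersection $\mathbb{R}^{n+1}$), with $\mathrm{rk}(W)=\mathrm{codim}(W)$. (This is the intersection lattice of the cone $\widehat{\mathcal{P}}$ over $\mathcal{P}$.) For $W\in L_{\widehat{\mathcal{P}}}$, $W\ne\mathbb{R}^{n+1}$, let $G_W$ be the graph whose vertices are the facets of $\mathcal{P}$ having an interior $(n-1)$-face $\tau$ with $W\subset H_\tau$, with $\sigma_1,\sigma_2$ adjacent iff $\sigma_1\cap\sigma_2=\tau\in\mathcal{P}_{n-1}$ with $W\subset H_\tau$. The components $\mathcal{P}_W^1,\dots,\mathcal{P}_W^m$ of $\mathcal{P}_W$ are the subcomplexes generated by the facets in the respective connected components of $G_W$. For $W=\mathbb{R}^{n+1}$ the components of $\mathcal{P}_W$ are the individual facets of $\mathcal{P}$. $C^r_W(\mathcal{P})=\bigoplus_{i=1}^m C^r_{\mathcal{P}_W^i}(\mathcal{P})$ and $LS^{r,k}(\mathcal{P})=\sum_{W\in L_{\widehat{\mathcal{P}}},\,0\le\mathrm{rk}(W)\le k}C^r_W(\mathcal{P})$. *)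

theory Defs
  imports "HOL-Analysis.Analysis" "HOL-Library.Set_Algebras" "HOL-Library.Function_Algebras"
begin

text \<open>
  The ambient space is a Euclidean space \<open>'a\<close> of dimension \<open>n = DIM('a)\<close>. The ring
  \<open>R = \<real>[x\<^sub>1,\<dots>,x\<^sub>n]\<close> is the ring of real polynomial functions on \<open>'a\<close>; as the real
  numbers are infinite, polynomials and polynomial functions are the same thing.
\<close>

section \<open>Polytopal complexes\<close>

text \<open>In the library, \<open>{}\<close> and \<open>S\<close> itself are faces of \<open>S\<close>, so a nonempty complex
  contains the empty face.\<close>

definition polytopal_complex :: "'a::euclidean_space set set \<Rightarrow> bool" where
  "polytopal_complex P \<longleftrightarrow>
     finite P \<and>
     (\<forall>\<sigma>\<in>P. polytope \<sigma>) \<and>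
     (\<forall>\<sigma>\<in>P. \<forall>\<phi>. \<phi> face_of \<sigma> \<longrightarrow> \<phi> \<in> P) \<and>
     (\<forall>\<sigma>\<in>P. \<forall>\<sigma>'\<in>P. \<sigma> \<inter> \<sigma>' face_of \<sigma> \<and> \<sigma> \<inter> \<sigma>' face_of \<sigma>')"

definition faces_dim :: "'a::euclidean_space set set \<Rightarrow> int \<Rightarrow> 'a set set" where
  "faces_dim P i = {\<phi> \<in> P. aff_dim \<phi> = i}"

definition facets :: "'a::euclidean_space set set \<Rightarrow> 'a set set" where
  "facets P = {\<sigma> \<in> P. \<forall>\<phi>\<in>P. \<sigma> \<subseteq> \<phi> \<longrightarrow> \<phi> = \<sigma>}"

definition pure_full_dim :: "'a::euclidean_space set set \<Rightarrow> bool" where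
  "pure_full_dim P \<longleftrightarrow> (\<forall>\<sigma>\<in>facets P. aff_dim \<sigma> = int DIM('a))"

abbreviation codim1_faces :: "'a::euclidean_space set set \<Rightarrow> 'a set set" where
  "codim1_faces P \<equiv> faces_dim P (int DIM('a) - 1)"

definition interior_codim1_faces :: "'a::euclidean_space set set \<Rightarrow> 'a set set" where
  "interior_codim1_faces P =
     {\<tau> \<in> codim1_faces P. \<exists>\<sigma>\<in>facets P. \<exists>\<sigma>'\<in>facets P. \<sigma> \<noteq> \<sigma>' \<and> \<tau> \<subseteq> \<sigma> \<and> \<tau> \<subseteq> \<sigma>'}"

text \<open>Graphs are given by a vertex set \<open>V\<close> and a symmetric relation \<open>E \<subseteq> V \<times> V\<close>.\<close>

definition graph_connected :: "'v set \<Rightarrow> ('v \<times> 'v) set \<Rightarrow> bool" where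
  "graph_connected V E \<longleftrightarrow> (\<forall>u\<in>V. \<forall>v\<in>V. (u, v) \<in> E\<^sup>*)"

definition graph_components :: "'v set \<Rightarrow> ('v \<times> 'v) set \<Rightarrow> 'v set set" where
  "graph_components V E = V // (E\<^sup>* \<inter> V \<times> V)"

definition facet_adj :: "'a::euclidean_space set set \<Rightarrow> ('a set \<times> 'a set) set" where
  "facet_adj P = {(\<sigma>, \<sigma>'). \<sigma> \<in> facets P \<and> \<sigma>' \<in> facets P \<and> \<sigma> \<inter> \<sigma>' \<in> codim1_faces P}"

definition generated_subcomplex :: "'a::euclidean_space set set \<Rightarrow> 'a set set" where
  "generated_subcomplex K = {\<phi>. \<exists>\<sigma>\<in>K. \<phi> face_of \<sigma>}"

definition face_star :: "'a::euclidean_space set set \<Rightarrow> 'a set \<Rightarrow> 'a set set" where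
  "face_star P \<gamma> = generated_subcomplex {\<sigma> \<in> facets P. \<gamma> \<subseteq> \<sigma>}"

definition hereditary :: "'a::euclidean_space set set \<Rightarrow> bool" where
  "hereditary P \<longleftrightarrow>
     (\<forall>\<gamma>\<in>P. \<gamma> \<noteq> {} \<longrightarrow>
        graph_connected (facets (face_star P \<gamma>)) (facet_adj (face_star P \<gamma>)))"

section \<open>Splines\<close>

definition poly_dvd :: "('a::real_normed_vector \<Rightarrow> real) \<Rightarrow> ('a \<Rightarrow> real) \<Rightarrow> bool" where
  "poly_dvd p q \<longleftrightarrow> (\<exists>g. real_polynomial_function g \<and> q = (\<lambda>x. p x * g x))"

definition generates_ideal_of :: "('a::euclidean_space \<Rightarrow> real) \<Rightarrow> 'a set \<Rightarrow> bool" where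
  "generates_ideal_of l S \<longleftrightarrow>
     {f. real_polynomial_function f \<and> (\<forall>x\<in>S. f x = 0)} = {f. poly_dvd l f}"

definition degree_one :: "('a::euclidean_space \<Rightarrow> real) \<Rightarrow> bool" where
  "degree_one l \<longleftrightarrow> (\<exists>a b. a \<noteq> 0 \<and> l = (\<lambda>x. a \<bullet> x + b))"

text \<open>The polynomial \<open>l\<^sub>\<tau>\<close>, well defined up to a nonzero constant factor; lemma
  \<open>face_poly\<close> below shows that it exists for every face of codimension one.\<close>

definition face_poly :: "'a::euclidean_space set \<Rightarrow> 'a \<Rightarrow> real" where
  "face_poly \<tau> = (SOME l. degree_one l \<and> generates_ideal_of l (affine hull \<tau>))"

lemma degree_one_generates:
  fixes a :: "'a::euclidean_space"
  assumes "a \<noteq> 0"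
  shows "generates_ideal_of (\<lambda>x. a \<bullet> x + b) {x. a \<bullet> x + b = 0}"
proof -
  define l where "l = (\<lambda>x. a \<bullet> x + b)"
  define p where "p = (\<lambda>x. x - (l x / (a \<bullet> a)) *\<^sub>R a)"
  have aa: "a \<bullet> a \<noteq> 0" using assms by simp
  have l: "real_polynomial_function l"
    unfolding l_def
    by (intro real_polynomial_function.intros bounded_linear_inner_right)
  have lp: "a \<bullet> p x + b = 0" for x
    using aa by (simp add: p_def l_def inner_diff_right)
  have main: "real_polynomial_function (\<lambda>x. f (p x)) \<and> poly_dvd l (\<lambda>x. f x - f (p x))"
    if "real_polynomial_function f" for f
    using that
  proof induction
    case (linear f)
    have e: "f (p x) = f x + l x * (- (f a / (a \<bullet> a)))" for x
      by (simp add: p_def bounded_linear.linear[OF linear] linear_diff linear_scale)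
    have "real_polynomial_function (\<lambda>x. f x + l x * (- (f a / (a \<bullet> a))))"
      by (rule real_polynomial_function.intros(3)[OF real_polynomial_function.intros(1)[OF linear]
            real_polynomial_function.intros(4)[OF l real_polynomial_function.intros(2)]])
    then have "real_polynomial_function (\<lambda>x. f (p x))"
      by (simp only: e)
    moreover have "poly_dvd l (\<lambda>x. f x - f (p x))"
      unfolding poly_dvd_def
      by (rule exI[of _ "\<lambda>_. f a / (a \<bullet> a)"]) (simp add: e real_polynomial_function.intros(2))
    ultimately show ?case ..
  next
    case (const c)
    have "poly_dvd l (\<lambda>x. 0)"
      unfolding poly_dvd_def
      by (rule exI[of _ "\<lambda>_. 0"]) (simp add: real_polynomial_function.intros(2))
    then show ?case by (simp add: real_polynomial_function.intros(2))
  next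
    case (add f g)
    have "poly_dvd l (\<lambda>x. f x - f (p x))" "poly_dvd l (\<lambda>x. g x - g (p x))"
      and fp: "real_polynomial_function (\<lambda>x. f (p x))"
      and gp: "real_polynomial_function (\<lambda>x. g (p x))"
      using add.IH by simp_all
    then obtain u v where uv:
      "real_polynomial_function u" "(\<lambda>x. f x - f (p x)) = (\<lambda>x. l x * u x)"
      "real_polynomial_function v" "(\<lambda>x. g x - g (p x)) = (\<lambda>x. l x * v x)"
      unfolding poly_dvd_def by (elim exE conjE)
    have "f x + g x - (f (p x) + g (p x)) = l x * (u x + v x)" for x
      using fun_cong[OF uv(2), of x] fun_cong[OF uv(4), of x] by (simp add: distrib_left)
    then have "poly_dvd l (\<lambda>x. f x + g x - (f (p x) + g (p x)))"
      unfolding poly_dvd_def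
      by (intro exI[of _ "\<lambda>x. u x + v x"] conjI real_polynomial_function.intros(3) uv(1,3) ext)
    with real_polynomial_function.intros(3)[OF fp gp] show ?case ..
  next
    case (mult f g)
    have "poly_dvd l (\<lambda>x. f x - f (p x))" "poly_dvd l (\<lambda>x. g x - g (p x))"
      and fp: "real_polynomial_function (\<lambda>x. f (p x))"
      and gp: "real_polynomial_function (\<lambda>x. g (p x))"
      using mult.IH by simp_all
    then obtain u v where uv:
      "real_polynomial_function u" "(\<lambda>x. f x - f (p x)) = (\<lambda>x. l x * u x)"
      "real_polynomial_function v" "(\<lambda>x. g x - g (p x)) = (\<lambda>x. l x * v x)"
      unfolding poly_dvd_def by (elim exE conjE)
    have "f x * g x - f (p x) * g (p x) = l x * (f x * v x + g (p x) * u x)" for x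
    proof -
      have "f x * g x - f (p x) * g (p x) = f x * (g x - g (p x)) + g (p x) * (f x - f (p x))"
        by (simp add: algebra_simps)
      also have "\<dots> = f x * (l x * v x) + g (p x) * (l x * u x)"
        using fun_cong[OF uv(2), of x] fun_cong[OF uv(4), of x] by simp
      finally show ?thesis by (simp add: algebra_simps)
    qed
    then have "poly_dvd l (\<lambda>x. f x * g x - f (p x) * g (p x))"
      unfolding poly_dvd_def
      by (intro exI[of _ "\<lambda>x. f x * v x + g (p x) * u x"] conjI ext
          real_polynomial_function.intros(3) real_polynomial_function.intros(4) uv(1,3) mult.hyps gp)
    with real_polynomial_function.intros(4)[OF fp gp] show ?case ..
  qed
  have "poly_dvd l f" if "real_polynomial_function f" "\<forall>x. a \<bullet> x + b = 0 \<longrightarrow> f x = 0" for f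
  proof -
    have "f (p x) = 0" for x
      using that(2) lp by blast
    then show ?thesis
      using main[OF that(1)] by simp
  qed
  moreover have "real_polynomial_function f \<and> (\<forall>x. a \<bullet> x + b = 0 \<longrightarrow> f x = 0)"
    if dvd: "poly_dvd l f" for f
  proof -
    obtain g where "real_polynomial_function g" "f = (\<lambda>x. l x * g x)"
      using dvd unfolding poly_dvd_def by blast
    then show ?thesis
      using real_polynomial_function.intros(4)[OF l] by (simp add: l_def)
  qed
  ultimately show ?thesis
    unfolding generates_ideal_of_def l_def by blast
qed

lemma face_poly:
  fixes \<tau> :: "'a::euclidean_space set"
  assumes "aff_dim \<tau> = int DIM('a) - 1"
  shows "degree_one (face_poly \<tau>)" "generates_ideal_of (face_poly \<tau>) (affine hull \<tau>)"
proof -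
  obtain a b where "a \<noteq> 0" and hull: "affine hull \<tau> = {x. a \<bullet> x = b}"
    using assms iffD1[OF aff_dim_eq_hyperplane, of \<tau>] DIM_positive[where 'a='a]
    by (auto simp: of_nat_diff)
  have "degree_one (\<lambda>x. a \<bullet> x + (- b))"
    unfolding degree_one_def using \<open>a \<noteq> 0\<close> by blast
  moreover have "generates_ideal_of (\<lambda>x. a \<bullet> x + (- b)) (affine hull \<tau>)"
    using degree_one_generates[OF \<open>a \<noteq> 0\<close>, of "- b"] by (simp add: hull)
  ultimately have "degree_one (\<lambda>x. a \<bullet> x + (- b)) \<and>
      generates_ideal_of (\<lambda>x. a \<bullet> x + (- b)) (affine hull \<tau>)" ..
  then have "degree_one (face_poly \<tau>) \<and> generates_ideal_of (face_poly \<tau>) (affine hull \<tau>)"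
    unfolding face_poly_def
    by (rule someI[where P = "\<lambda>l. degree_one l \<and> generates_ideal_of l (affine hull \<tau>)"])
  then show "degree_one (face_poly \<tau>)" "generates_ideal_of (face_poly \<tau>) (affine hull \<tau>)"
    by auto
qed

text \<open>An element of the direct sum of copies of \<open>R\<close> indexed by the \<open>n\<close>-faces is a function
  on sets that vanishes off the \<open>n\<close>-faces, so that addition of tuples is addition of
  functions.\<close>

definition splines :: "nat \<Rightarrow> 'a::euclidean_space set set \<Rightarrow> ('a set \<Rightarrow> 'a \<Rightarrow> real) set" where
  "splines r P =
     {F. (\<forall>\<sigma>\<in>faces_dim P (int DIM('a)). real_polynomial_function (F \<sigma>)) \<and>
         (\<forall>\<sigma>. \<sigma> \<notin> faces_dim P (int DIM('a)) \<longrightarrow> F \<sigma> = 0) \<and>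
         (\<forall>\<sigma>\<in>faces_dim P (int DIM('a)). \<forall>\<sigma>'\<in>faces_dim P (int DIM('a)).
            \<sigma> \<inter> \<sigma>' \<in> codim1_faces P \<longrightarrow>
            poly_dvd (\<lambda>x. face_poly (\<sigma> \<inter> \<sigma>') x ^ (r + 1)) (F \<sigma> - F \<sigma>'))}"

definition splines_on ::
    "nat \<Rightarrow> 'a::euclidean_space set set \<Rightarrow> 'a set set \<Rightarrow> ('a set \<Rightarrow> 'a \<Rightarrow> real) set" where
  "splines_on r P Q = {F \<in> splines r P. \<forall>\<sigma>\<in>facets P. \<sigma> \<notin> Q \<longrightarrow> F \<sigma> = 0}"

section \<open>The intersection lattice and lattice-supported splines\<close>

text \<open>The space \<open>\<real>\<^sup>n\<^sup>+\<^sup>1\<close> containing the cone over \<open>P\<close> is the product \<open>real \<times> 'a\<close>.\<close>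

definition cone_hyperplane :: "'a::euclidean_space set \<Rightarrow> (real \<times> 'a) set" where
  "cone_hyperplane \<tau> = span ({1} \<times> \<tau>)"

definition intersection_lattice :: "'a::euclidean_space set set \<Rightarrow> (real \<times> 'a) set set" where
  "intersection_lattice P = {\<Inter>(cone_hyperplane ` T) | T. T \<subseteq> interior_codim1_faces P}"

definition rk :: "(real \<times> 'a::euclidean_space) set \<Rightarrow> nat" where
  "rk W = DIM(real \<times> 'a) - dim W"

definition graph_verts_at ::
    "'a::euclidean_space set set \<Rightarrow> (real \<times> 'a) set \<Rightarrow> 'a set set" where
  "graph_verts_at P W =
     {\<sigma> \<in> facets P. \<exists>\<tau>\<in>interior_codim1_faces P. \<tau> \<subseteq> \<sigma> \<and> W \<subseteq> cone_hyperplane \<tau>}"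

definition graph_adj_at ::
    "'a::euclidean_space set set \<Rightarrow> (real \<times> 'a) set \<Rightarrow> ('a set \<times> 'a set) set" where
  "graph_adj_at P W =
     {(\<sigma>, \<sigma>'). \<sigma> \<in> graph_verts_at P W \<and> \<sigma>' \<in> graph_verts_at P W \<and>
        \<sigma> \<inter> \<sigma>' \<in> codim1_faces P \<and> W \<subseteq> cone_hyperplane (\<sigma> \<inter> \<sigma>')}"

definition complex_components_at ::
    "'a::euclidean_space set set \<Rightarrow> (real \<times> 'a) set \<Rightarrow> 'a set set set" where
  "complex_components_at P W =
     (if W = UNIV then (\<lambda>\<sigma>. generated_subcomplex {\<sigma>}) ` facets P
      else generated_subcomplex ` graph_components (graph_verts_at P W) (graph_adj_at P W))"

text \<open>Below, sums of sets of tuples are the elementwise sums of \<open>HOL-Library.Set_Algebras\<close>,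
  that is, sums of submodules; the index sets are finite for finite \<open>P\<close>. The sum over the
  components of \<open>P\<^sub>W\<close> is an internal direct sum because distinct components share no facets.\<close>

definition splines_at ::
    "nat \<Rightarrow> 'a::euclidean_space set set \<Rightarrow> (real \<times> 'a) set \<Rightarrow> ('a set \<Rightarrow> 'a \<Rightarrow> real) set" where
  "splines_at r P W = (\<Sum>Q\<in>complex_components_at P W. splines_on r P Q)"

definition LS :: "nat \<Rightarrow> nat \<Rightarrow> 'a::euclidean_space set set \<Rightarrow> ('a set \<Rightarrow> 'a \<Rightarrow> real) set" where
  "LS r k P = (\<Sum>W | W \<in> intersection_lattice P \<and> rk W \<le> k. splines_at r P W)"

end

theory Submission
  imports Defs
begin

text \<open>
  Only the inclusion of the splines in the lattice-supported ones needs an argument. Write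
  \<open>l\<^sub>\<tau>\<close> for the form of an interior face \<open>\<tau>\<close> of codimension one. If a spline \<open>F\<close> is multiplied
  by a polynomial divisible by \<open>l\<^sub>\<tau> ^ (r + 1)\<close>, it may be cut off along \<open>\<tau>\<close>: setting the product
  to zero on one side leaves a spline. Hence if a monomial \<open>u = \<Prod>\<^sub>\<tau> l\<^sub>\<tau> ^ e \<tau>\<close> has exponent at
  least \<open>r + 1\<close> outside a set \<open>T\<close> of faces, and \<open>W\<close> is the intersection of the hyperplanes
  \<open>H\<^sub>\<tau>\<close> with \<open>\<tau> \<in> T\<close>, then \<open>u F\<close> is the sum of its restrictions to the components of \<open>P\<^sub>W\<close> and to
  the single facets outside \<open>P\<^sub>W\<close>, the latter being components at the whole space. If the
  \<open>l\<^sub>\<tau>\<close> with \<open>\<tau> \<in> T\<close> have a common zero \<open>p\<close>, then \<open>(1, p) \<in> W\<close>, so \<open>W\<close> has rank at most \<open>n\<close> and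
  \<open>u F\<close> is lattice-supported (lemma \<open>face_monomial_mult_in_LS_of_common_zero\<close>).

  Instead of localizing at maximal ideals, lemma \<open>face_monomial_mult_in_LS\<close> shows by descent on
  the exponents that \<open>u F\<close> is lattice-supported for all \<open>e\<close> and all splines \<open>F\<close>. Let \<open>T\<close> be the set
  of faces with exponent at most \<open>r\<close>. If the \<open>l\<^sub>\<tau>\<close> with \<open>\<tau> \<in> T\<close> have no common zero, then linear
  algebra gives constants with \<open>1 = \<Sum>\<^sub>\<tau> c \<tau> * l\<^sub>\<tau>\<close> over \<open>T\<close>
  (lemma \<open>affine_forms_common_zero_or_unit\<close>), and \<open>u F\<close> is the sum of the \<open>(u * l\<^sub>\<tau>) (c \<tau> F)\<close>,
  in each of which one exponent has grown. The case \<open>e = 0\<close> is the theorem.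
\<close>

section \<open>Sums of sets closed under addition\<close>

lemma zero_in_set_sum:
  fixes B :: "'i \<Rightarrow> 'b::comm_monoid_add set"
  assumes "\<And>i. i \<in> I \<Longrightarrow> 0 \<in> B i"
  shows "0 \<in> sum B I"
  using assms
proof (induction I rule: infinite_finite_induct)
  case (insert i I)
  then have "0 + 0 \<in> B i + sum B I" by (intro set_plus_intro) auto
  with insert show ?case by simp
qed auto

lemma subset_set_sum:
  fixes B :: "'i \<Rightarrow> 'b::comm_monoid_add set"
  assumes "finite I" "i \<in> I" "\<And>i. i \<in> I \<Longrightarrow> 0 \<in> B i"
  shows "B i \<subseteq> sum B I"
proof
  fix x assume "x \<in> B i"
  moreover have "0 \<in> sum B (I - {i})" using assms(3) by (intro zero_in_set_sum) auto
  ultimately have "x + 0 \<in> B i + sum B (I - {i})" by (rule set_plus_intro)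
  then show "x \<in> sum B I" using assms(1,2) by (simp add: sum.remove)
qed

lemma set_sum_closed_add:
  fixes B :: "'i \<Rightarrow> 'b::comm_monoid_add set"
  assumes "\<And>i x y. i \<in> I \<Longrightarrow> x \<in> B i \<Longrightarrow> y \<in> B i \<Longrightarrow> x + y \<in> B i"
    and "x \<in> sum B I" "y \<in> sum B I"
  shows "x + y \<in> sum B I"
  using assms
proof (induction I arbitrary: x y rule: infinite_finite_induct)
  case (insert i I)
  then obtain a b c d where *: "x = a + b" "y = c + d" "a \<in> B i" "c \<in> B i"
    "b \<in> sum B I" "d \<in> sum B I"
    by (auto simp: set_plus_def)
  have "a + c \<in> B i" using insert.prems(1) * by auto
  moreover have "b + d \<in> sum B I" using insert.IH insert.prems(1) * by auto
  ultimately have "(a + c) + (b + d) \<in> B i + sum B I" by (rule set_plus_intro)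
  then show ?case using * insert.hyps by (simp add: ac_simps)
qed auto

lemma set_sum_subset:
  fixes B :: "'i \<Rightarrow> 'b::comm_monoid_add set"
  assumes "0 \<in> M" "\<And>x y. x \<in> M \<Longrightarrow> y \<in> M \<Longrightarrow> x + y \<in> M" "\<And>i. i \<in> I \<Longrightarrow> B i \<subseteq> M"
  shows "sum B I \<subseteq> M"
  using assms(3)
proof (induction I rule: infinite_finite_induct)
  case (insert i I)
  then show ?case using assms(2) by (fastforce simp: set_plus_def)
qed (use assms(1) in auto)

lemma sum_mem_closed:
  assumes "0 \<in> M" "\<And>x y. x \<in> M \<Longrightarrow> y \<in> M \<Longrightarrow> x + y \<in> M" "\<And>i. i \<in> I \<Longrightarrow> f i \<in> M"
  shows "sum f I \<in> M"
  using assms(3) by (induction I rule: infinite_finite_induct) (auto intro: assms(1,2))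

lemma sum_fun_apply:
  fixes f :: "'i \<Rightarrow> 'a \<Rightarrow> 'b::comm_monoid_add"
  shows "(\<Sum>i\<in>I. f i) x = (\<Sum>i\<in>I. f i x)"
  by (induction I rule: infinite_finite_induct) auto

section \<open>Divisibility of polynomial functions and modules of splines\<close>

lemma poly_dvd_zero: "poly_dvd p 0"
  unfolding poly_dvd_def by (rule exI[of _ "\<lambda>_. 0"]) (auto simp: fun_eq_iff)

lemma poly_dvd_add: "poly_dvd p f \<Longrightarrow> poly_dvd p g \<Longrightarrow> poly_dvd p (f + g)"
  unfolding poly_dvd_def
  by (elim exE conjE, rule_tac x = "\<lambda>x. ga x + gaa x" in exI) (auto simp: fun_eq_iff algebra_simps)

lemma poly_dvd_mult:
  assumes "poly_dvd p f" "real_polynomial_function q"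
  shows "poly_dvd p (\<lambda>x. q x * f x)"
proof -
  obtain g where "real_polynomial_function g" "f = (\<lambda>x. p x * g x)"
    using assms(1) unfolding poly_dvd_def by blast
  with assms(2) show ?thesis
    unfolding poly_dvd_def by (intro exI[of _ "\<lambda>x. q x * g x"]) (auto simp: fun_eq_iff)
qed

lemma splines_zero:
  fixes P :: "'a::euclidean_space set set"
  shows "0 \<in> splines r P"
proof -
  have "real_polynomial_function (0 :: 'a \<Rightarrow> real)"
    using real_polynomial_function.intros(2)[of 0] by (simp add: zero_fun_def)
  then show ?thesis by (simp add: splines_def poly_dvd_zero)
qed

lemma splines_add:
  assumes "F \<in> splines r P" "G \<in> splines r P"
  shows "F + G \<in> splines r P"
proof -
  have *: "(F + G) \<sigma> - (F + G) \<sigma>' = (F \<sigma> - F \<sigma>') + (G \<sigma> - G \<sigma>')" for \<sigma> \<sigma>'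
    by (simp add: fun_eq_iff)
  have **: "real_polynomial_function ((F + G) \<sigma>)"
    if "real_polynomial_function (F \<sigma>)" "real_polynomial_function (G \<sigma>)" for \<sigma>
    using real_polynomial_function.intros(3)[OF that] by (simp add: plus_fun_def)
  show ?thesis
    using assms unfolding splines_def mem_Collect_eq *
    by (intro conjI ballI allI impI poly_dvd_add **) auto
qed

lemma splines_mult:
  assumes "F \<in> splines r P" "real_polynomial_function p"
  shows "(\<lambda>\<sigma> x. p x * F \<sigma> x) \<in> splines r P"
proof -
  have *: "(\<lambda>x. p x * F \<sigma> x) - (\<lambda>x. p x * F \<sigma>' x) = (\<lambda>x. p x * (F \<sigma> - F \<sigma>') x)" for \<sigma> \<sigma>'
    by (simp add: fun_eq_iff algebra_simps)
  have **: "(\<lambda>x. p x * F \<sigma> x) = 0" if "F \<sigma> = 0" for \<sigma>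
    using that by (simp add: fun_eq_iff)
  show ?thesis
    using assms unfolding splines_def mem_Collect_eq *
    by (intro conjI ballI allI impI poly_dvd_mult real_polynomial_function.intros(4) **)
       (auto simp: fun_diff_def)
qed

lemma splines_on_zero: "0 \<in> splines_on r P Q"
  by (simp add: splines_on_def splines_zero)

lemma splines_on_add:
  "F \<in> splines_on r P Q \<Longrightarrow> G \<in> splines_on r P Q \<Longrightarrow> F + G \<in> splines_on r P Q"
  by (simp add: splines_on_def splines_add)

lemma splines_at_zero: "0 \<in> splines_at r P W"
  unfolding splines_at_def by (intro zero_in_set_sum splines_on_zero)

lemma splines_at_add:
  "F \<in> splines_at r P W \<Longrightarrow> G \<in> splines_at r P W \<Longrightarrow> F + G \<in> splines_at r P W"
  unfolding splines_at_def by (rule set_sum_closed_add) (auto intro: splines_on_add)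

lemma LS_zero: "0 \<in> LS r k P"
  unfolding LS_def by (intro zero_in_set_sum splines_at_zero)

lemma LS_add: "F \<in> LS r k P \<Longrightarrow> G \<in> LS r k P \<Longrightarrow> F + G \<in> LS r k P"
  unfolding LS_def by (rule set_sum_closed_add) (auto intro: splines_at_add)

lemma LS_subset_splines: "LS r k P \<subseteq> splines r P"
  unfolding LS_def splines_at_def
  by (intro set_sum_subset splines_zero splines_add) (auto simp: splines_on_def)

section \<open>Facets and interior faces\<close>

lemma facets_subset: "facets P \<subseteq> P"
  by (auto simp: facets_def)

lemma finite_interior_codim1_faces: "polytopal_complex P \<Longrightarrow> finite (interior_codim1_faces P)"
  by (auto simp: interior_codim1_faces_def faces_dim_def polytopal_complex_def)

lemma finite_facets: "polytopal_complex P \<Longrightarrow> finite (facets P)"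
  by (meson facets_subset finite_subset polytopal_complex_def)

lemma full_dim_faces_eq_facets:
  fixes P :: "'a::euclidean_space set set"
  assumes P: "polytopal_complex P" and pure: "pure_full_dim P"
  shows "faces_dim P (int DIM('a)) = facets P"
proof
  show "facets P \<subseteq> faces_dim P (int DIM('a))"
    using pure facets_subset by (auto simp: faces_dim_def pure_full_dim_def)
  show "faces_dim P (int DIM('a)) \<subseteq> facets P"
  proof
    fix \<sigma> assume "\<sigma> \<in> faces_dim P (int DIM('a))"
    then have \<sigma>: "\<sigma> \<in> P" "aff_dim \<sigma> = int DIM('a)" by (auto simp: faces_dim_def)
    have "\<phi> = \<sigma>" if \<phi>: "\<phi> \<in> P" "\<sigma> \<subseteq> \<phi>" for \<phi>
    proof (rule ccontr)
      assume "\<phi> \<noteq> \<sigma>"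
      have "\<sigma> \<inter> \<phi> face_of \<phi>" "convex \<phi>"
        using P \<sigma> \<phi> by (auto simp: polytopal_complex_def polytope_imp_convex)
      then have "aff_dim \<sigma> < aff_dim \<phi>"
        using \<phi> \<open>\<phi> \<noteq> \<sigma>\<close> by (intro face_of_aff_dim_lt) (auto simp: Int_absorb2)
      then show False using \<sigma> aff_dim_le_DIM[of \<phi>] by simp
    qed
    with \<sigma> show "\<sigma> \<in> facets P" by (auto simp: facets_def)
  qed
qed

lemma adjacent_facets_interior:
  fixes P :: "'a::euclidean_space set set"
  assumes "polytopal_complex P" "pure_full_dim P"
    and "\<sigma> \<in> facets P" "\<sigma>' \<in> facets P" "\<sigma> \<inter> \<sigma>' \<in> codim1_faces P"
  shows "\<sigma> \<inter> \<sigma>' \<in> interior_codim1_faces P"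
proof -
  have "\<sigma> \<noteq> \<sigma>'"
    using assms(2-5) by (auto simp: faces_dim_def pure_full_dim_def)
  then show ?thesis using assms(3-5) by (auto simp: interior_codim1_faces_def)
qed

lemma facet_in_generated_subcomplex:
  assumes "polytopal_complex P" "\<sigma> \<in> K" "K \<subseteq> facets P"
  shows "\<sigma> \<in> generated_subcomplex K"
proof -
  have "convex \<sigma>" using assms facets_subset[of P]
    by (auto simp: polytopal_complex_def polytope_imp_convex)
  then show ?thesis using assms(2) face_of_refl by (auto simp: generated_subcomplex_def)
qed

section \<open>Linear forms of faces of codimension one\<close>

lemma interior_aff_dim:
  fixes P :: "'a::euclidean_space set set"
  shows "\<tau> \<in> interior_codim1_faces P \<Longrightarrow> aff_dim \<tau> = int DIM('a) - 1"
  by (auto simp: interior_codim1_faces_def faces_dim_def)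

lemma real_polynomial_function_affine:
  fixes a :: "'a::euclidean_space"
  shows "real_polynomial_function (\<lambda>x. a \<bullet> x + b)"
  by (intro real_polynomial_function.intros(3)[OF real_polynomial_function.intros(1,2)]
      bounded_linear_inner_right)

lemma real_polynomial_function_face_poly:
  fixes \<tau> :: "'a::euclidean_space set"
  assumes "aff_dim \<tau> = int DIM('a) - 1"
  shows "real_polynomial_function (face_poly \<tau>)"
proof -
  obtain a b where "face_poly \<tau> = (\<lambda>x. a \<bullet> x + b)"
    using face_poly(1)[OF assms] by (auto simp: degree_one_def)
  then show ?thesis by (simp add: real_polynomial_function_affine)
qed

lemma face_poly_eq_0_iff:
  fixes \<tau> :: "'a::euclidean_space set"
  assumes "aff_dim \<tau> = int DIM('a) - 1"
  shows "face_poly \<tau> p = 0 \<longleftrightarrow> p \<in> affine hull \<tau>"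
proof -
  have gen: "real_polynomial_function f \<and> (\<forall>x\<in>affine hull \<tau>. f x = 0) \<longleftrightarrow> poly_dvd (face_poly \<tau>) f" for f
    using face_poly(2)[OF assms] unfolding generates_ideal_of_def by blast
  obtain a b where "a \<noteq> 0" and hull: "affine hull \<tau> = {x. a \<bullet> x = b}"
    using assms iffD1[OF aff_dim_eq_hyperplane, of \<tau>] DIM_positive[where 'a='a]
    by (auto simp: of_nat_diff)
  have "real_polynomial_function (\<lambda>x. a \<bullet> x + (- b))"
    by (rule real_polynomial_function_affine)
  then have "poly_dvd (face_poly \<tau>) (\<lambda>x. a \<bullet> x + (- b))"
    using gen[of "\<lambda>x. a \<bullet> x + (- b)"] by (simp add: hull)
  then obtain g where g: "(\<lambda>x. a \<bullet> x + (- b)) = (\<lambda>x. face_poly \<tau> x * g x)"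
    unfolding poly_dvd_def by blast
  have "poly_dvd (face_poly \<tau>) (face_poly \<tau>)"
    unfolding poly_dvd_def by (intro exI[of _ "\<lambda>_. 1"]) auto
  then have "\<forall>x\<in>affine hull \<tau>. face_poly \<tau> x = 0" using gen by blast
  moreover have "p \<in> affine hull \<tau>" if "face_poly \<tau> p = 0"
    using fun_cong[OF g, of p] that by (simp add: hull)
  ultimately show ?thesis by blast
qed

lemma affine_hull_imp_cone_hyperplane:
  assumes "p \<in> affine hull \<tau>"
  shows "(1, p) \<in> cone_hyperplane \<tau>"
proof -
  have "affine {x. (1, x) \<in> span ({1::real} \<times> \<tau>)}"
    unfolding affine_def
  proof (intro ballI allI impI)
    fix x y and u v :: real
    assume "x \<in> {x. (1, x) \<in> span ({1::real} \<times> \<tau>)}" "y \<in> {x. (1, x) \<in> span ({1::real} \<times> \<tau>)}"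
      and "u + v = 1"
    then have "u *\<^sub>R (1, x) + v *\<^sub>R (1, y) \<in> span ({1::real} \<times> \<tau>)"
      by (intro span_add span_scale) auto
    with \<open>u + v = 1\<close> show "u *\<^sub>R x + v *\<^sub>R y \<in> {x. (1, x) \<in> span ({1::real} \<times> \<tau>)}" by simp
  qed
  then have "affine hull \<tau> \<subseteq> {x. (1, x) \<in> span ({1::real} \<times> \<tau>)}"
    by (intro hull_minimal) (auto intro: span_base)
  then show ?thesis using assms by (auto simp: cone_hyperplane_def)
qed

lemma cone_hyperplane_ne_UNIV:
  fixes \<tau> :: "'a::euclidean_space set"
  assumes "aff_dim \<tau> = int DIM('a) - 1"
  shows "cone_hyperplane \<tau> \<noteq> UNIV"
proof -
  obtain a b where "a \<noteq> 0" and hull: "affine hull \<tau> = {x. a \<bullet> x = b}"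
    using assms iffD1[OF aff_dim_eq_hyperplane, of \<tau>] DIM_positive[where 'a='a]
    by (auto simp: of_nat_diff)
  have "cone_hyperplane \<tau> \<subseteq> {z. (- b, a) \<bullet> z = 0}"
    unfolding cone_hyperplane_def
    using hull hull_subset[of \<tau> affine] by (intro span_minimal subspace_hyperplane) auto
  moreover have "(0, a) \<notin> {z. (- b, a) \<bullet> z = 0}" using \<open>a \<noteq> 0\<close> by simp
  ultimately show ?thesis by blast
qed

text \<open>The linear form of the Nullstellensatz: affine functions without a common zero have the
  constant \<open>1\<close> among their linear combinations. Otherwise a vector orthogonal to their coefficient
  vectors, but not to that of the constant, would be a common zero in homogeneous coordinates.\<close>

lemma affine_forms_common_zero_or_unit:
  fixes l :: "'i \<Rightarrow> 'a::euclidean_space \<Rightarrow> real"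
  assumes "finite T" and deg: "\<And>i. i \<in> T \<Longrightarrow> degree_one (l i)"
    and nozero: "\<And>p. \<exists>i\<in>T. l i p \<noteq> 0"
  shows "\<exists>c. \<forall>x. (\<Sum>i\<in>T. c i * l i x) = 1"
proof -
  obtain a b where l: "\<And>i. i \<in> T \<Longrightarrow> l i = (\<lambda>x. a i \<bullet> x + b i)"
    using deg unfolding degree_one_def by metis
  define v where "v = (\<lambda>i. (b i, a i))"
  have lv: "l i x = v i \<bullet> (1, x)" if "i \<in> T" for i x
    using that by (simp add: l v_def)
  have "(1, 0) \<in> span (v ` T)"
  proof (rule ccontr)
    assume notin: "(1, 0) \<notin> span (v ` T)"
    obtain y z where y: "y \<in> span (v ` T)" and z: "\<And>w. w \<in> span (v ` T) \<Longrightarrow> orthogonal z w"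
      and yz: "(1, 0) = y + z"
      using orthogonal_subspace_decomp_exists by metis
    have "z \<noteq> 0" using notin y yz by auto
    moreover have "z \<bullet> (1, 0) = z \<bullet> z"
      using z[OF y] yz by (simp add: inner_right_distrib orthogonal_def)
    ultimately have fz: "fst z \<noteq> 0" by (cases z) (auto simp: zero_prod_def)
    have "l i ((1 / fst z) *\<^sub>R snd z) = 0" if "i \<in> T" for i
    proof -
      have "v i \<bullet> z = 0"
        using z[of "v i"] that by (auto simp: orthogonal_def inner_commute intro: span_base)
      then show ?thesis using fz that by (cases z) (simp add: l v_def field_simps)
    qed
    with nozero show False by blast
  qed
  moreover have "span (v ` T) \<subseteq> range (\<lambda>c. \<Sum>i\<in>T. c i *\<^sub>R v i)"
  proof (rule span_minimal)
    show "v ` T \<subseteq> range (\<lambda>c. \<Sum>i\<in>T. c i *\<^sub>R v i)"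
    proof (rule image_subsetI)
      fix i assume "i \<in> T"
      then have "v i = (\<Sum>j\<in>T. (if j = i then 1 else 0) *\<^sub>R v j)"
        using \<open>finite T\<close> by (simp add: if_distrib[of "\<lambda>c. c *\<^sub>R _"] sum.delta cong: if_cong)
      then show "v i \<in> range (\<lambda>c. \<Sum>i\<in>T. c i *\<^sub>R v i)"
        by (rule range_eqI[of _ _ "\<lambda>j. if j = i then 1 else 0"])
    qed
    show "subspace (range (\<lambda>c. \<Sum>i\<in>T. c i *\<^sub>R v i))"
      unfolding subspace_def
    proof (intro conjI ballI allI)
      show "0 \<in> range (\<lambda>c. \<Sum>i\<in>T. c i *\<^sub>R v i)"
        by (rule range_eqI[of _ _ "\<lambda>_. 0"]) simp
    next
      fix x y assume "x \<in> range (\<lambda>c. \<Sum>i\<in>T. c i *\<^sub>R v i)" "y \<in> range (\<lambda>c. \<Sum>i\<in>T. c i *\<^sub>R v i)"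
      then obtain c d where "x = (\<Sum>i\<in>T. c i *\<^sub>R v i)" "y = (\<Sum>i\<in>T. d i *\<^sub>R v i)" by blast
      then show "x + y \<in> range (\<lambda>c. \<Sum>i\<in>T. c i *\<^sub>R v i)"
        by (intro range_eqI[of _ _ "\<lambda>i. c i + d i"]) (simp add: scaleR_add_left sum.distrib)
    next
      fix k x assume "x \<in> range (\<lambda>c. \<Sum>i\<in>T. c i *\<^sub>R v i)"
      then obtain c where "x = (\<Sum>i\<in>T. c i *\<^sub>R v i)" by blast
      then show "k *\<^sub>R x \<in> range (\<lambda>c. \<Sum>i\<in>T. c i *\<^sub>R v i)"
        by (intro range_eqI[of _ _ "\<lambda>i. k * c i"]) (simp add: scaleR_sum_right)
    qed
  qed
  ultimately obtain c where c: "(1, 0) = (\<Sum>i\<in>T. c i *\<^sub>R v i)" by blast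
  have "(\<Sum>i\<in>T. c i * l i x) = 1" for x
  proof -
    have "(\<Sum>i\<in>T. c i * l i x) = (\<Sum>i\<in>T. c i *\<^sub>R v i) \<bullet> (1, x)"
      by (simp add: inner_sum_left lv)
    also have "\<dots> = 1" by (simp add: c[symmetric])
    finally show ?thesis .
  qed
  then show ?thesis by blast
qed

section \<open>Splitting a multiple of a spline along a flat\<close>

text \<open>The product of the forms of the interior faces of codimension one, with exponents \<open>e\<close>.\<close>

definition face_monomial ::
    "'a::euclidean_space set set \<Rightarrow> ('a set \<Rightarrow> nat) \<Rightarrow> 'a \<Rightarrow> real" where
  "face_monomial P e x = (\<Prod>\<tau>\<in>interior_codim1_faces P. face_poly \<tau> x ^ e \<tau>)"

text \<open>The tuple that agrees with \<open>F\<close> on the facets in \<open>K\<close> and is zero elsewhere.\<close>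

definition restrict_spline ::
    "'a set set \<Rightarrow> ('a set \<Rightarrow> 'a \<Rightarrow> real) \<Rightarrow> 'a set \<Rightarrow> 'a \<Rightarrow> real" where
  "restrict_spline K F = (\<lambda>\<sigma>. if \<sigma> \<in> K then F \<sigma> else 0)"

lemma real_polynomial_function_face_monomial:
  assumes "polytopal_complex P"
  shows "real_polynomial_function (face_monomial P e)"
proof -
  have "real_polynomial_function (\<lambda>x. \<Prod>\<tau>\<in>interior_codim1_faces P. face_poly \<tau> x ^ e \<tau>)"
    by (intro real_polynomial_function_prod real_polynomial_function_power
        finite_interior_codim1_faces assms real_polynomial_function_face_poly)
       (auto dest: interior_aff_dim)
  then show ?thesis by (simp add: face_monomial_def[abs_def])
qed

lemma face_monomial_Suc:
  assumes "polytopal_complex P" "\<tau> \<in> interior_codim1_faces P"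
  shows "face_monomial P (e(\<tau> := Suc (e \<tau>))) x = face_poly \<tau> x * face_monomial P e x"
proof -
  have "(\<Prod>\<rho>\<in>interior_codim1_faces P - {\<tau>}. face_poly \<rho> x ^ (e(\<tau> := Suc (e \<tau>))) \<rho>) =
      (\<Prod>\<rho>\<in>interior_codim1_faces P - {\<tau>}. face_poly \<rho> x ^ e \<rho>)"
    by (intro prod.cong) auto
  then show ?thesis
    using assms unfolding face_monomial_def
    by (simp add: prod.remove[OF finite_interior_codim1_faces] mult.assoc)
qed

lemma face_power_dvd_face_monomial:
  assumes P: "polytopal_complex P" and \<tau>: "\<tau> \<in> interior_codim1_faces P" and "k \<le> e \<tau>"
  shows "poly_dvd (\<lambda>x. face_poly \<tau> x ^ k) (face_monomial P e)"
proof -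
  define e' where "e' = e(\<tau> := e \<tau> - k)"
  have "(\<Prod>\<rho>\<in>interior_codim1_faces P - {\<tau>}. face_poly \<rho> x ^ e' \<rho>) =
      (\<Prod>\<rho>\<in>interior_codim1_faces P - {\<tau>}. face_poly \<rho> x ^ e \<rho>)" for x
    by (intro prod.cong) (auto simp: e'_def)
  moreover have "face_poly \<tau> x ^ e \<tau> = face_poly \<tau> x ^ k * face_poly \<tau> x ^ e' \<tau>" for x
    using \<open>k \<le> e \<tau>\<close> by (simp add: e'_def power_add[symmetric])
  ultimately have "face_monomial P e = (\<lambda>x. face_poly \<tau> x ^ k * face_monomial P e' x)"
    using P \<tau> unfolding face_monomial_def
    by (simp add: fun_eq_iff prod.remove[OF finite_interior_codim1_faces] mult.assoc)
  then show ?thesis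
    unfolding poly_dvd_def using real_polynomial_function_face_monomial[OF P] by blast
qed

text \<open>Cutting a spline off along faces whose forms divide it to the power \<open>r + 1\<close> leaves a
  spline.\<close>

lemma restrict_face_monomial_mult:
  fixes P :: "'a::euclidean_space set set"
  assumes P: "polytopal_complex P" and pure: "pure_full_dim P" and F: "F \<in> splines r P"
    and K: "K \<subseteq> facets P"
    and cut: "\<And>\<sigma> \<sigma>'. \<sigma> \<in> K \<Longrightarrow> \<sigma>' \<in> facets P - K \<Longrightarrow> \<sigma> \<inter> \<sigma>' \<in> codim1_faces P \<Longrightarrow>
      r + 1 \<le> e (\<sigma> \<inter> \<sigma>')"
  shows "restrict_spline K (\<lambda>\<sigma> x. face_monomial P e x * F \<sigma> x)
      \<in> splines_on r P (generated_subcomplex K)"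
proof -
  define G where "G = (\<lambda>\<sigma> x. face_monomial P e x * F \<sigma> x)"
  note fd = full_dim_faces_eq_facets[OF P pure]
  have G: "G \<in> splines r P"
    unfolding G_def by (intro splines_mult F real_polynomial_function_face_monomial P)
  have dvd: "poly_dvd (\<lambda>x. face_poly (\<sigma> \<inter> \<sigma>') x ^ (r + 1)) (\<lambda>x. c * G \<rho> x)"
    if "\<sigma> \<in> K" "\<sigma>' \<in> facets P - K" "\<sigma> \<inter> \<sigma>' \<in> codim1_faces P" "\<rho> \<in> facets P" for \<sigma> \<sigma>' \<rho> c
  proof -
    have "\<sigma> \<inter> \<sigma>' \<in> interior_codim1_faces P"
      using that K by (intro adjacent_facets_interior[OF P pure]) auto
    moreover have "real_polynomial_function (F \<rho>)"
      using F that(4) by (simp add: splines_def fd)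
    ultimately have "poly_dvd (\<lambda>x. face_poly (\<sigma> \<inter> \<sigma>') x ^ (r + 1))
        (\<lambda>x. (c * F \<rho> x) * face_monomial P e x)"
      using cut that
      by (intro poly_dvd_mult face_power_dvd_face_monomial[OF P]) auto
    then show ?thesis by (simp add: G_def ac_simps)
  qed
  have "poly_dvd (\<lambda>x. face_poly (\<sigma> \<inter> \<sigma>') x ^ (r + 1))
      (restrict_spline K G \<sigma> - restrict_spline K G \<sigma>')"
    if *: "\<sigma> \<in> facets P" "\<sigma>' \<in> facets P" "\<sigma> \<inter> \<sigma>' \<in> codim1_faces P" for \<sigma> \<sigma>'
  proof -
    consider "\<sigma> \<in> K" "\<sigma>' \<in> K" | "\<sigma> \<in> K" "\<sigma>' \<notin> K" | "\<sigma> \<notin> K" "\<sigma>' \<in> K" | "\<sigma> \<notin> K" "\<sigma>' \<notin> K"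
      by blast
    then show ?thesis
    proof cases
      case 1
      then show ?thesis using G * by (simp add: restrict_spline_def splines_def fd)
    next
      case 2
      then have "restrict_spline K G \<sigma> - restrict_spline K G \<sigma>' = (\<lambda>x. 1 * G \<sigma> x)"
        by (simp add: restrict_spline_def fun_eq_iff)
      then show ?thesis using dvd[of \<sigma> \<sigma>' \<sigma> 1] 2 * by simp
    next
      case 3
      then have "restrict_spline K G \<sigma> - restrict_spline K G \<sigma>' = (\<lambda>x. - 1 * G \<sigma>' x)"
        by (simp add: restrict_spline_def fun_eq_iff)
      then show ?thesis using dvd[of \<sigma>' \<sigma> \<sigma>' "- 1"] 3 * by (simp add: Int_commute)
    next
      case 4
      then show ?thesis by (simp add: restrict_spline_def poly_dvd_zero)
    qed
  qed
  moreover have "real_polynomial_function (restrict_spline K G \<sigma>)" if "\<sigma> \<in> facets P" for \<sigma>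
    using G that by (auto simp: restrict_spline_def splines_def fd zero_fun_def)
  moreover have "restrict_spline K G \<sigma> = 0" if "\<sigma> \<notin> K" for \<sigma>
    using that by (simp add: restrict_spline_def)
  ultimately have "restrict_spline K G \<in> splines_on r P (generated_subcomplex K)"
    unfolding splines_on_def splines_def fd mem_Collect_eq
    using K facet_in_generated_subcomplex[OF P _ K] by blast
  then show ?thesis by (simp only: G_def)
qed

lemma finite_graph_components: "finite V \<Longrightarrow> finite (graph_components V E)"
  by (simp add: graph_components_def quotient_def)

lemma splines_on_subset_LS:
  fixes P :: "'a::euclidean_space set set"
  assumes P: "polytopal_complex P" and W: "W \<in> intersection_lattice P" "rk W \<le> k"
    and Q: "Q \<in> complex_components_at P W"
  shows "splines_on r P Q \<subseteq> LS r k P"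
proof -
  have fV: "finite (graph_verts_at P W)"
    using finite_facets[OF P] by (auto simp: graph_verts_at_def)
  have "finite (complex_components_at P W)"
    using finite_facets[OF P] finite_graph_components[OF fV]
    by (auto simp: complex_components_at_def)
  then have "splines_on r P Q \<subseteq> splines_at r P W"
    unfolding splines_at_def using Q by (intro subset_set_sum splines_on_zero)
  moreover have "finite (intersection_lattice P)"
  proof -
    have "intersection_lattice P = (\<lambda>T. \<Inter>(cone_hyperplane ` T)) ` Pow (interior_codim1_faces P)"
      by (auto simp: intersection_lattice_def)
    then show ?thesis using finite_interior_codim1_faces[OF P] by simp
  qed
  then have "splines_at r P W \<subseteq> LS r k P"
    unfolding LS_def using W by (intro subset_set_sum splines_at_zero) auto
  ultimately show ?thesis by blast
qed

text \<open>If the faces whose exponent is at most \<open>r\<close> have a common point in their affine spans, then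
  these faces define a flat \<open>W\<close> of rank at most \<open>n\<close>, and the multiple of \<open>F\<close> is the sum of its
  restrictions to the components of \<open>P\<^sub>W\<close> and to the facets outside \<open>P\<^sub>W\<close>.\<close>

lemma face_monomial_mult_in_LS_of_common_zero:
  fixes P :: "'a::euclidean_space set set"
  assumes P: "polytopal_complex P" and pure: "pure_full_dim P" and F: "F \<in> splines r P"
    and zero: "\<And>\<tau>. \<tau> \<in> interior_codim1_faces P \<Longrightarrow> e \<tau> < r + 1 \<Longrightarrow> face_poly \<tau> p = 0"
  shows "(\<lambda>\<sigma> x. face_monomial P e x * F \<sigma> x) \<in> LS r DIM('a) P"
proof -
  define T where "T = {\<tau> \<in> interior_codim1_faces P. e \<tau> < r + 1}"
  define W where "W = \<Inter>(cone_hyperplane ` T)"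
  define G where "G = (\<lambda>\<sigma> x. face_monomial P e x * F \<sigma> x)"
  define V where "V = graph_verts_at P W"
  define C where "C = graph_components V (graph_adj_at P W)"
  note fd = full_dim_faces_eq_facets[OF P pure]
  have G0: "G \<sigma> = 0" if "\<sigma> \<notin> facets P" for \<sigma>
    using F that by (simp add: G_def splines_def fd fun_eq_iff)
  have W: "W \<in> intersection_lattice P"
    unfolding intersection_lattice_def W_def T_def by blast
  have rkW: "rk W \<le> DIM('a)"
  proof -
    have "(1, p) \<in> W"
      unfolding W_def T_def
      using zero face_poly_eq_0_iff[OF interior_aff_dim, of _ P p]
      by (auto intro!: affine_hull_imp_cone_hyperplane)
    then have "\<not> W \<subseteq> {0}" by (auto simp: zero_prod_def)
    then have "dim W \<ge> 1" using dim_eq_0[of W] by linarith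
    then show ?thesis using diff_le_mono2[of 1 "dim W" "Suc DIM('a)"] by (simp add: rk_def)
  qed
  have U: "UNIV \<in> intersection_lattice P" "rk (UNIV :: (real \<times> 'a) set) \<le> DIM('a)"
    by (auto simp: intersection_lattice_def rk_def dim_UNIV intro: exI[of _ "{}"])
  have adj: "(\<sigma>, \<sigma>') \<in> graph_adj_at P W \<and> (\<sigma>', \<sigma>) \<in> graph_adj_at P W"
    if "\<sigma> \<in> facets P" "\<sigma>' \<in> facets P" "\<sigma> \<inter> \<sigma>' \<in> codim1_faces P" "\<not> r + 1 \<le> e (\<sigma> \<inter> \<sigma>')" for \<sigma> \<sigma>'
  proof -
    have int: "\<sigma> \<inter> \<sigma>' \<in> interior_codim1_faces P"
      using adjacent_facets_interior[OF P pure that(1-3)] .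
    moreover have "W \<subseteq> cone_hyperplane (\<sigma> \<inter> \<sigma>')"
      using int that(4) by (auto simp: W_def T_def)
    ultimately have "\<sigma> \<in> graph_verts_at P W" "\<sigma>' \<in> graph_verts_at P W"
      using that(1,2) by (auto simp: graph_verts_at_def)
    with that \<open>W \<subseteq> _\<close> show ?thesis by (simp add: graph_adj_at_def Int_commute)
  qed
  \<comment> \<open>A facet isolated in the adjacency at \<open>W\<close> is a component at the whole space, of rank \<open>0\<close>.\<close>
  have single: "restrict_spline {\<sigma>} G \<in> LS r DIM('a) P"
    if "\<sigma> \<in> facets P" "\<And>\<sigma>'. (\<sigma>, \<sigma>') \<notin> graph_adj_at P W" for \<sigma>
  proof -
    have "restrict_spline {\<sigma>} G \<in> splines_on r P (generated_subcomplex {\<sigma>})"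
      unfolding G_def
    proof (rule restrict_face_monomial_mult[OF P pure F])
      show "r + 1 \<le> e (\<rho> \<inter> \<rho>')"
        if "\<rho> \<in> {\<sigma>}" "\<rho>' \<in> facets P - {\<sigma>}" "\<rho> \<inter> \<rho>' \<in> codim1_faces P" for \<rho> \<rho>'
        using adj[of \<rho> \<rho>'] that \<open>\<sigma> \<in> facets P\<close> \<open>\<And>\<sigma>'. (\<sigma>, \<sigma>') \<notin> graph_adj_at P W\<close> by auto
    qed (use that in auto)
    moreover have "generated_subcomplex {\<sigma>} \<in> complex_components_at P UNIV"
      using that(1) by (auto simp: complex_components_at_def)
    ultimately show ?thesis using splines_on_subset_LS[OF P U] by blast
  qed
  have V: "V \<subseteq> facets P" by (auto simp: V_def graph_verts_at_def)
  then have fV: "finite V" using finite_facets[OF P] finite_subset by blast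
  have fC: "finite C" using fV by (simp add: C_def finite_graph_components)
  have EV: "graph_adj_at P W \<subseteq> V \<times> V" by (auto simp: V_def graph_adj_at_def)
  have "sym ((graph_adj_at P W)\<^sup>*)"
    by (intro sym_rtrancl) (auto simp: graph_adj_at_def sym_def Int_commute)
  then have equiv: "equiv V ((graph_adj_at P W)\<^sup>* \<inter> V \<times> V)"
    by (auto simp: equiv_def refl_on_def sym_def trans_def)
  show ?thesis
  proof (cases "W = UNIV")
    case True
    \<comment> \<open>No hyperplane contains the whole space, so all facets are isolated.\<close>
    have "graph_adj_at P W = {}"
      using cone_hyperplane_ne_UNIV True
      by (force simp: graph_adj_at_def faces_dim_def)
    then have "restrict_spline {\<sigma>} G \<in> LS r DIM('a) P" if "\<sigma> \<in> facets P" for \<sigma>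
      using single that by simp
    then have "(\<Sum>\<sigma>\<in>facets P. restrict_spline {\<sigma>} G) \<in> LS r DIM('a) P"
      by (intro sum_mem_closed LS_zero LS_add)
    also have "(\<Sum>\<sigma>\<in>facets P. restrict_spline {\<sigma>} G) = G"
    proof
      fix \<rho>
      have "(\<Sum>\<sigma>\<in>facets P. restrict_spline {\<sigma>} G) \<rho> = (\<Sum>\<sigma>\<in>facets P. if \<rho> = \<sigma> then G \<rho> else 0)"
        by (simp add: restrict_spline_def sum_fun_apply)
      also have "\<dots> = G \<rho>"
        using finite_facets[OF P] G0 by (simp add: sum.delta)
      finally show "(\<Sum>\<sigma>\<in>facets P. restrict_spline {\<sigma>} G) \<rho> = G \<rho>" .
    qed
    finally show ?thesis by (simp add: G_def)
  next
    case False
    have comp: "restrict_spline K G \<in> LS r DIM('a) P" if "K \<in> C" for K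
    proof -
      have "K \<subseteq> V" using that equiv
        by (metis C_def Union_quotient Union_upper graph_components_def)
      have "restrict_spline K G \<in> splines_on r P (generated_subcomplex K)"
        unfolding G_def
      proof (rule restrict_face_monomial_mult[OF P pure F])
        show "K \<subseteq> facets P" using \<open>K \<subseteq> V\<close> V by blast
        fix \<rho> \<rho>' assume *: "\<rho> \<in> K" "\<rho>' \<in> facets P - K" "\<rho> \<inter> \<rho>' \<in> codim1_faces P"
        show "r + 1 \<le> e (\<rho> \<inter> \<rho>')"
        proof (rule ccontr)
          assume "\<not> r + 1 \<le> e (\<rho> \<inter> \<rho>')"
          then have "(\<rho>, \<rho>') \<in> graph_adj_at P W" using adj * \<open>K \<subseteq> V\<close> V by blast
          then have "(\<rho>, \<rho>') \<in> (graph_adj_at P W)\<^sup>* \<inter> V \<times> V" using EV by auto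
          then have "\<rho>' \<in> K"
            using in_quotient_imp_closed[OF equiv] that \<open>\<rho> \<in> K\<close>
            unfolding C_def graph_components_def by blast
          with * show False by blast
        qed
      qed
      moreover have "generated_subcomplex K \<in> complex_components_at P W"
        using that False by (auto simp: complex_components_at_def C_def V_def)
      ultimately show ?thesis using splines_on_subset_LS[OF P W rkW] by blast
    qed
    have "restrict_spline {\<sigma>} G \<in> LS r DIM('a) P" if "\<sigma> \<in> facets P - V" for \<sigma>
      using that EV by (intro single) auto
    then have "(\<Sum>K\<in>C. restrict_spline K G) + (\<Sum>\<sigma>\<in>facets P - V. restrict_spline {\<sigma>} G)
        \<in> LS r DIM('a) P"
      using comp by (intro LS_add sum_mem_closed[OF LS_zero LS_add]) auto
    also have "(\<Sum>K\<in>C. restrict_spline K G) + (\<Sum>\<sigma>\<in>facets P - V. restrict_spline {\<sigma>} G) = G"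
    proof
      fix \<rho>
      have UC: "\<Union>C = V"
        using Union_quotient[OF equiv] by (simp add: C_def graph_components_def)
      have "(\<Sum>\<sigma>\<in>facets P - V. restrict_spline {\<sigma>} G) \<rho> =
          (\<Sum>\<sigma>\<in>facets P - V. if \<rho> = \<sigma> then G \<rho> else 0)"
        by (simp add: restrict_spline_def sum_fun_apply)
      also have "\<dots> = (if \<rho> \<in> V then 0 else G \<rho>)"
        using finite_facets[OF P] G0 by (auto simp: sum.delta)
      finally have 1: "(\<Sum>\<sigma>\<in>facets P - V. restrict_spline {\<sigma>} G) \<rho> = (if \<rho> \<in> V then 0 else G \<rho>)" .
      have 2: "(\<Sum>K\<in>C. restrict_spline K G) \<rho> = (if \<rho> \<in> V then G \<rho> else 0)"
      proof (cases "\<rho> \<in> V")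
        case True
        then obtain K0 where K0: "K0 \<in> C" "\<rho> \<in> K0" using UC by blast
        have uniq: "\<rho> \<in> K \<longleftrightarrow> K = K0" if "K \<in> C" for K
          using quotient_disj[OF equiv, of K K0] that K0
          unfolding C_def graph_components_def by blast
        have "(\<Sum>K\<in>C. restrict_spline K G) \<rho> = (\<Sum>K\<in>C. if K = K0 then G \<rho> else 0)"
          by (auto simp: restrict_spline_def uniq sum_fun_apply intro!: sum.cong)
        also have "\<dots> = G \<rho>" using fC K0 by (simp add: sum.delta)
        finally show ?thesis using True by simp
      next
        case False
        then have "\<rho> \<notin> K" if "K \<in> C" for K using UC that by blast
        then show ?thesis using False by (simp add: restrict_spline_def sum_fun_apply)
      qed
      show "((\<Sum>K\<in>C. restrict_spline K G) + (\<Sum>\<sigma>\<in>facets P - V. restrict_spline {\<sigma>} G)) \<rho> = G \<rho>"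
        using 1 2 by simp
    qed
    finally show ?thesis by (simp add: G_def)
  qed
qed

section \<open>Descent on the exponents\<close>

text \<open>The induction is on the total amount by which the exponents fall short of \<open>r + 1\<close>.\<close>

lemma face_monomial_mult_in_LS:
  fixes P :: "'a::euclidean_space set set"
  assumes P: "polytopal_complex P" and pure: "pure_full_dim P" and "F \<in> splines r P"
  shows "(\<lambda>\<sigma> x. face_monomial P e x * F \<sigma> x) \<in> LS r DIM('a) P"
  using assms(3)
proof (induction "\<Sum>\<tau>\<in>interior_codim1_faces P. r + 1 - e \<tau>" arbitrary: e F rule: less_induct)
  case less
  define T where "T = {\<tau> \<in> interior_codim1_faces P. e \<tau> < r + 1}"
  have fI: "finite (interior_codim1_faces P)" using P by (rule finite_interior_codim1_faces)
  show ?case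
  proof (cases "\<exists>p. \<forall>\<tau>\<in>T. face_poly \<tau> p = 0")
    case True
    then show ?thesis
      using face_monomial_mult_in_LS_of_common_zero[OF P pure less.prems] by (auto simp: T_def)
  next
    case False
    have "degree_one (face_poly \<tau>)" if "\<tau> \<in> T" for \<tau>
      using that by (auto simp: T_def intro!: face_poly(1) dest: interior_aff_dim)
    then obtain c where c: "\<And>x. (\<Sum>\<tau>\<in>T. c \<tau> * face_poly \<tau> x) = 1"
      using affine_forms_common_zero_or_unit[of T face_poly] False fI by (auto simp: T_def)
    have step: "(\<lambda>\<sigma> x. face_monomial P (e(\<tau> := Suc (e \<tau>))) x * (c \<tau> * F \<sigma> x)) \<in> LS r DIM('a) P"
      if "\<tau> \<in> T" for \<tau>
    proof (rule less.hyps)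
      show "(\<Sum>\<rho>\<in>interior_codim1_faces P. r + 1 - (e(\<tau> := Suc (e \<tau>))) \<rho>)
          < (\<Sum>\<rho>\<in>interior_codim1_faces P. r + 1 - e \<rho>)"
        using that fI by (intro sum_strict_mono_ex1) (auto simp: T_def)
      show "(\<lambda>\<sigma> x. c \<tau> * F \<sigma> x) \<in> splines r P"
        using less.prems by (intro splines_mult) auto
    qed
    have "(\<Sum>\<tau>\<in>T. (\<lambda>\<sigma> x. face_monomial P (e(\<tau> := Suc (e \<tau>))) x * (c \<tau> * F \<sigma> x)))
        \<in> LS r DIM('a) P"
      using step by (intro sum_mem_closed LS_zero LS_add)
    also have "(\<Sum>\<tau>\<in>T. (\<lambda>\<sigma> x. face_monomial P (e(\<tau> := Suc (e \<tau>))) x * (c \<tau> * F \<sigma> x))) =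
        (\<lambda>\<sigma> x. face_monomial P e x * F \<sigma> x)"
    proof (intro ext)
      fix \<sigma> x
      have "(\<Sum>\<tau>\<in>T. (\<lambda>\<sigma> x. face_monomial P (e(\<tau> := Suc (e \<tau>))) x * (c \<tau> * F \<sigma> x))) \<sigma> x =
          (\<Sum>\<tau>\<in>T. face_monomial P (e(\<tau> := Suc (e \<tau>))) x * (c \<tau> * F \<sigma> x))"
        by (simp add: sum_fun_apply)
      also have "\<dots> = (\<Sum>\<tau>\<in>T. (c \<tau> * face_poly \<tau> x) * (face_monomial P e x * F \<sigma> x))"
        by (intro sum.cong) (auto simp: T_def face_monomial_Suc[OF P])
      also have "\<dots> = face_monomial P e x * F \<sigma> x"
        by (simp add: sum_distrib_right[symmetric] c)
      finally show "(\<Sum>\<tau>\<in>T. (\<lambda>\<sigma> x. face_monomial P (e(\<tau> := Suc (e \<tau>))) x * (c \<tau> * F \<sigma> x))) \<sigma> x =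
          face_monomial P e x * F \<sigma> x" .
    qed
    finally show ?thesis .
  qed
qed

theorem corollary4p4:
  fixes P :: "(real ^ 'n) set set" and r :: nat
  assumes "polytopal_complex P"
    and "pure_full_dim P"
    and "hereditary P"
  shows "LS r CARD('n) P = splines r P"
proof
  show "LS r CARD('n) P \<subseteq> splines r P" by (rule LS_subset_splines)
  show "splines r P \<subseteq> LS r CARD('n) P"
  proof
    fix F assume "F \<in> splines r P"
    from face_monomial_mult_in_LS[OF assms(1,2) this, of "\<lambda>_. 0"]
    show "F \<in> LS r CARD('n) P" by (simp add: face_monomial_def)
  qed
qed

end
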